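(* Let $P$ be a FAC poset. Then $\mathbf{w}(P)$ equals the height of the poset $(\mathcal{A}(P),\supseteq)$, where $\mathcal{A}(P)$ is the set of all non-empty antichains of $P$; that is, $\mathbf{w}(P)$ is the least ordinal $\gamma$ for which there is a function $r:\mathcal{A}(P)\to\gamma$ with $S\supsetneq T\implies r(S)<r(T)$ for all $S,T\in\mathcal{A}(P)$.
   Context: A poset is FAC (finite antichain condition) if all its antichains are finite; then $(\mathcal{A}(P),\supseteq)$ is well-founded. For a FAC poset $P$, let $\mathrm{Inc}(P)$ be the tree of all non-empty finite sequences $\langle x_0,\dots,x_n\rangle$ of pairwise incomparable elements of $P$, ordered by strict initial segment $s\sqsubset t$. The width $\mathbf{w}(P)$ is the rank of this tree: the least ordinal $\gamma$ such that there is $f:\mathrm{Inc}(P)\to\gamma$ with $s\sqsubset t\implies f(s)>f(t)$. *)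

theory Defs
  imports "HOL-Library.Sublist"
begin

unbundle cardinal_syntax

text \<open>
  A poset is a carrier set \<open>P\<close> with a relation \<open>le\<close> satisfying \<^term>\<open>partial_order_on P le\<close>.
\<close>

definition incomparable :: "'a rel \<Rightarrow> 'a \<Rightarrow> 'a \<Rightarrow> bool" where
  "incomparable le x y \<longleftrightarrow> (x, y) \<notin> le \<and> (y, x) \<notin> le"

definition antichain :: "'a set \<Rightarrow> 'a rel \<Rightarrow> 'a set \<Rightarrow> bool" where
  "antichain P le S \<longleftrightarrow> S \<subseteq> P \<and> pairwise (incomparable le) S"

definition FAC :: "'a set \<Rightarrow> 'a rel \<Rightarrow> bool" where
  "FAC P le \<longleftrightarrow> (\<forall>S. antichain P le S \<longrightarrow> finite S)"

definition antichains :: "'a set \<Rightarrow> 'a rel \<Rightarrow> 'a set set" where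
  "antichains P le = {S. antichain P le S \<and> S \<noteq> {}}"

text \<open>
  Since incomparability is symmetric, \<^const>\<open>sorted_wrt\<close>, which only compares an entry with
  later ones, expresses pairwise incomparability. By reflexivity of \<open>le\<close> on \<open>P\<close>, such a list
  has no repetitions.
\<close>

definition Inc :: "'a set \<Rightarrow> 'a rel \<Rightarrow> 'a list set" where
  "Inc P le = {xs. xs \<noteq> [] \<and> set xs \<subseteq> P \<and> sorted_wrt (incomparable le) xs}"

text \<open>
  Ordinals are represented by well-orders, identified up to \<open>=o\<close>; the elements of an ordinal
  \<open>\<gamma>\<close> are those of \<^term>\<open>Field \<gamma>\<close>, with \<^term>\<open>\<gamma> - Id\<close> as the strict order.
\<close>

definition strict_map_into :: "'c set \<Rightarrow> ('c \<Rightarrow> 'c \<Rightarrow> bool) \<Rightarrow> 'b rel \<Rightarrow> bool" where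
  "strict_map_into A R \<gamma> \<longleftrightarrow>
     (\<exists>f. f ` A \<subseteq> Field \<gamma> \<and> (\<forall>x\<in>A. \<forall>y\<in>A. R x y \<longrightarrow> (f x, f y) \<in> \<gamma> - Id))"

text \<open>
  The height of \<open>(A, R)\<close> is the least ordinal admitting a strictly increasing map from \<open>A\<close>.
  Comparing \<open>\<gamma>\<close> only with well-orders \<open>\<delta>\<close> on the same type loses nothing: every ordinal smaller
  than \<open>\<gamma>\<close> is isomorphic to a proper initial segment of \<open>\<gamma>\<close>.
\<close>

definition is_height :: "'c set \<Rightarrow> ('c \<Rightarrow> 'c \<Rightarrow> bool) \<Rightarrow> 'b rel \<Rightarrow> bool" where
  "is_height A R \<gamma> \<longleftrightarrow>
     Well_order \<gamma> \<and> strict_map_into A R \<gamma> \<and>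
     (\<forall>\<delta> :: 'b rel. Well_order \<delta> \<and> strict_map_into A R \<delta> \<longrightarrow> \<gamma> \<le>o \<delta>)"

text \<open>
  The rank of a tree under strict initial segment is the height of the reversed order: the map
  has to decrease along \<^const>\<open>strict_prefix\<close>.
\<close>

definition is_width :: "'a set \<Rightarrow> 'a rel \<Rightarrow> 'b rel \<Rightarrow> bool" where
  "is_width P le \<gamma> \<longleftrightarrow> is_height (Inc P le) (\<lambda>t s. strict_prefix s t) \<gamma>"

end

theory Submission imports Defs begin

text \<open>
  If \<open>r\<close> decreases along proper inclusion of antichains, then \<open>r \<circ> set\<close> decreases along the
  tree. Conversely, given \<open>f\<close> on the tree, let \<open>r S\<close> be the minimum of \<open>f\<close> over all enumerations
  of \<open>S\<close>: for \<open>T \<subset> S\<close>, an optimal enumeration of \<open>T\<close> extends to an enumeration of \<open>S\<close>, on which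
  \<open>f\<close> is smaller. So the two orders map into the same ordinals. Some ordinal does receive a map,
  because \<open>FAC\<close> makes the tree well-founded.
\<close>

lemma strict_map_intoI:
  assumes "\<And>x. x \<in> A \<Longrightarrow> f x \<in> Field \<gamma>"
    and "\<And>x y. x \<in> A \<Longrightarrow> y \<in> A \<Longrightarrow> R x y \<Longrightarrow> (f x, f y) \<in> \<gamma> - Id"
  shows "strict_map_into A R \<gamma>"
  unfolding strict_map_into_def
proof (intro exI conjI ballI impI)
  show "f ` A \<subseteq> Field \<gamma>"
    using assms(1) by (rule image_subsetI)
qed (rule assms(2))

lemma strict_map_intoE:
  assumes "strict_map_into A R \<gamma>"
  obtains f where "\<And>x. x \<in> A \<Longrightarrow> f x \<in> Field \<gamma>"
    and "\<And>x y. x \<in> A \<Longrightarrow> y \<in> A \<Longrightarrow> R x y \<Longrightarrow> (f x, f y) \<in> \<gamma> - Id"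
proof -
  obtain f where "f ` A \<subseteq> Field \<gamma>" "\<forall>x\<in>A. \<forall>y\<in>A. R x y \<longrightarrow> (f x, f y) \<in> \<gamma> - Id"
    using assms unfolding strict_map_into_def by (elim exE conjE)
  then show thesis
    by (intro that[of f]) (simp_all add: image_subset_iff)
qed

section \<open>Sequences and antichains\<close>

text \<open>Reflexivity makes each element of \<open>P\<close> comparable to itself, which excludes
  repetitions. A sequence is thus an enumeration of its range, and the range is an
  antichain.\<close>

lemma Inc_iff_distinct_antichains:
  assumes "refl_on P le"
  shows "xs \<in> Inc P le \<longleftrightarrow> distinct xs \<and> set xs \<in> antichains P le"
proof -
  have "sorted_wrt (incomparable le) xs \<longleftrightarrow> distinct xs \<and> pairwise (incomparable le) (set xs)"
    if "set xs \<subseteq> P"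
    using that refl_onD[OF assms]
    by (induction xs) (auto simp: pairwise_insert incomparable_def)
  then show ?thesis
    by (auto simp: Inc_def antichains_def antichain_def)
qed

text \<open>Append an enumeration of \<open>S - T\<close>, which is finite by \<open>FAC\<close>.
  The order of entries is irrelevant to incomparability.\<close>

lemma Inc_extend_to_superset:
  assumes "refl_on P le" "FAC P le" "T \<subset> S" "S \<in> antichains P le"
    and "xs \<in> Inc P le" "set xs = T"
  obtains ys where "ys \<in> Inc P le" "set ys = S" "strict_prefix xs ys"
proof -
  have "finite S"
    using assms by (auto simp: FAC_def antichains_def)
  then obtain zs where zs: "set zs = S - T" "distinct zs"
    using finite_distinct_list[of "S - T"] by auto
  show thesis
  proof
    show "set (xs @ zs) = S"
      using assms zs by auto
    then show "xs @ zs \<in> Inc P le"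
      using assms zs by (auto simp: Inc_iff_distinct_antichains)
    show "strict_prefix xs (xs @ zs)"
      using assms(3) zs by (auto simp: strict_prefix_def)
  qed
qed

lemma set_psubset_of_strict_prefix:
  assumes "strict_prefix xs ys" "distinct ys"
  shows "set xs \<subset> set ys"
proof -
  obtain z zs where "ys = xs @ z # zs"
    using strict_prefixE'[OF assms(1)] .
  with assms(2) show ?thesis by auto
qed

lemma strict_map_into_Inc_iff_antichains:
  fixes \<gamma> :: "'b rel"
  assumes refl: "refl_on P le" and FAC: "FAC P le" and wo: "Well_order \<gamma>"
  shows "strict_map_into (Inc P le) (\<lambda>t s. strict_prefix s t) \<gamma> \<longleftrightarrow>
    strict_map_into (antichains P le) (\<lambda>S T. S \<supset> T) \<gamma>"
proof
  assume "strict_map_into (antichains P le) (\<lambda>S T. S \<supset> T) \<gamma>"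
  then show "strict_map_into (Inc P le) (\<lambda>t s. strict_prefix s t) \<gamma>"
  proof (rule strict_map_intoE)
    fix r
    assume r: "\<And>S. S \<in> antichains P le \<Longrightarrow> r S \<in> Field \<gamma>"
      "\<And>S T. S \<in> antichains P le \<Longrightarrow> T \<in> antichains P le \<Longrightarrow> S \<supset> T \<Longrightarrow> (r S, r T) \<in> \<gamma> - Id"
    show ?thesis
    proof (rule strict_map_intoI[where f = "\<lambda>xs. r (set xs)"])
      show "r (set xs) \<in> Field \<gamma>" if "xs \<in> Inc P le" for xs
        using r(1) that by (simp add: Inc_iff_distinct_antichains[OF refl])
      show "(r (set t), r (set s)) \<in> \<gamma> - Id"
        if "t \<in> Inc P le" "s \<in> Inc P le" "strict_prefix s t" for s t
        using that set_psubset_of_strict_prefix[of s t]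
        by (intro r(2)) (simp_all add: Inc_iff_distinct_antichains[OF refl])
    qed
  qed
next
  assume "strict_map_into (Inc P le) (\<lambda>t s. strict_prefix s t) \<gamma>"
  then obtain f where f: "\<And>s. s \<in> Inc P le \<Longrightarrow> f s \<in> Field \<gamma>"
    "\<And>t s. t \<in> Inc P le \<Longrightarrow> s \<in> Inc P le \<Longrightarrow> strict_prefix s t \<Longrightarrow> (f t, f s) \<in> \<gamma> - Id"
    by (rule strict_map_intoE) (rule that; assumption)
  interpret wo_rel \<gamma>
    by unfold_locales (rule wo)
  define enums where "enums S = {xs \<in> Inc P le. set xs = S}" for S
  define r where "r S = minim (f ` enums S)" for S
  have sub: "f ` enums S \<subseteq> Field \<gamma>" for S
    using f(1) by (auto simp: enums_def)
  have ne: "f ` enums S \<noteq> {}" if "S \<in> antichains P le" for S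
  proof -
    have "finite S"
      using FAC that by (auto simp: FAC_def antichains_def)
    then obtain xs where "set xs = S" "distinct xs"
      using finite_distinct_list by blast
    with that show ?thesis
      by (auto simp: enums_def Inc_iff_distinct_antichains[OF refl])
  qed
  have less: "(r S, r T) \<in> \<gamma> - Id"
    if S: "S \<in> antichains P le" and T: "T \<in> antichains P le" and "T \<subset> S" for S T
  proof -
    obtain xs where xs: "xs \<in> Inc P le" "set xs = T" "r T = f xs"
      using minim_in[OF sub ne[OF T]] by (auto simp: r_def enums_def)
    obtain ys where ys: "ys \<in> Inc P le" "set ys = S" "strict_prefix xs ys"
      using Inc_extend_to_superset[OF refl FAC \<open>T \<subset> S\<close> S xs(1,2)] .
    \<comment> \<open>\<open>ys\<close> competes in the minimum defining \<open>r S\<close>, so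
      \<open>r S\<close> \<le> \<open>f ys\<close> < \<open>f xs\<close> =
      \<open>r T\<close>.\<close>
    have "(r S, f ys) \<in> \<gamma>"
      unfolding r_def using ys by (intro minim_least sub) (auto simp: enums_def)
    moreover have "(f ys, r T) \<in> \<gamma> - Id"
      using f(2) xs ys by auto
    ultimately show ?thesis
      using TRANS ANTISYM by (auto dest: transD antisymD)
  qed
  show "strict_map_into (antichains P le) (\<lambda>S T. S \<supset> T) \<gamma>"
  proof (rule strict_map_intoI)
    show "r S \<in> Field \<gamma>" if "S \<in> antichains P le" for S
      using minim_in[OF sub ne[OF that]] sub[of S] unfolding r_def by blast
  qed (rule less)
qed

text \<open>The ranges along an infinite branch increase, and their union would be an infinite
  antichain.\<close>

lemma wf_Inc:
  assumes refl: "refl_on P le" and FAC: "FAC P le"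
  shows "wf {(t, s). t \<in> Inc P le \<and> s \<in> Inc P le \<and> strict_prefix s t}"
  unfolding wf_iff_no_infinite_down_chain
proof
  assume "\<exists>f. \<forall>i. (f (Suc i), f i) \<in> {(t, s). t \<in> Inc P le \<and> s \<in> Inc P le \<and> strict_prefix s t}"
  then obtain f where f: "\<And>i. f i \<in> Inc P le" "\<And>i. strict_prefix (f i) (f (Suc i))"
    by blast
  have anti: "distinct (f i)" "antichain P le (set (f i))" for i
    using f(1)[of i] by (auto simp: Inc_iff_distinct_antichains[OF refl] antichains_def)
  have mono: "set (f i) \<subseteq> set (f j)" if "i \<le> j" for i j
    using that
    by (rule lift_Suc_mono_le[rotated])
      (use f(2) in \<open>auto simp: strict_prefix_def dest: set_mono_prefix\<close>)
  define S where "S = (\<Union>i. set (f i))"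
  have "incomparable le x y" if xy: "x \<in> S" "y \<in> S" "x \<noteq> y" for x y
  proof -
    obtain i j where "x \<in> set (f i)" "y \<in> set (f j)"
      using xy by (auto simp: S_def)
    then have "x \<in> set (f (max i j))" "y \<in> set (f (max i j))"
      using mono[of i "max i j"] mono[of j "max i j"] by auto
    with anti(2) xy(3) show ?thesis
      by (auto simp: antichain_def pairwise_def)
  qed
  then have "antichain P le S"
    using anti(2) by (auto simp: antichain_def pairwise_def S_def)
  with FAC have fin: "finite S"
    by (auto simp: FAC_def)
  \<comment> \<open>Lengths grow without bound, whereas a repetition-free list over \<open>S\<close>
    has length at most \<open>card S\<close>; the clash occurs at index
    \<open>Suc (card S)\<close>.\<close>
  have "n \<le> length (f n)" for n
  proof (induction n)
    case (Suc n)
    have "length (f n) < length (f (Suc n))"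
      using f(2) by (rule prefix_length_less)
    with Suc show ?case by simp
  qed simp
  moreover have "length (f n) \<le> card S" for n
    using card_mono[OF fin, of "set (f n)"] anti(1)[of n] by (auto simp: S_def distinct_card)
  ultimately have "Suc (card S) \<le> card S"
    using le_trans by blast
  then show False by simp
qed

section \<open>The rank of a well-founded relation\<close>

text \<open>
  Comparison of ranks without ordinals: \<open>rank x \<le> rank y\<close> iff every rank below that of \<open>x\<close> is
  bounded by a rank below that of \<open>y\<close>.
\<close>

inductive rank_le :: "'c rel \<Rightarrow> 'c \<Rightarrow> 'c \<Rightarrow> bool" for R where
  "(\<And>x'. (x', x) \<in> R \<Longrightarrow> \<exists>y'. (y', y) \<in> R \<and> rank_le R x' y') \<Longrightarrow> rank_le R x y"

lemma rank_le_iff: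
  "rank_le R x y \<longleftrightarrow> (\<forall>x'. (x', x) \<in> R \<longrightarrow> (\<exists>y'. (y', y) \<in> R \<and> rank_le R x' y'))"
  by (subst rank_le.simps) auto

lemma rank_le_trans:
  assumes "rank_le R x y" "rank_le R y z"
  shows "rank_le R x z"
  using assms
proof (induction arbitrary: z)
  case (1 x y)
  show ?case
    unfolding rank_le_iff[of R x z] using 1 rank_le_iff[of R y z] by blast
qed

text \<open>If \<open>rank_le R x y\<close> fails, some \<open>x'\<close> below \<open>x\<close> is
  bounded by no \<open>y'\<close> below \<open>y\<close>. By induction at \<open>x'\<close>, every
  such \<open>y'\<close> is bounded by \<open>x'\<close>, hence
  \<open>rank_le R y x\<close>.\<close>

lemma rank_le_linear:
  assumes "wf R"
  shows "rank_le R x y \<or> rank_le R y x"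
  using assms
proof (induction x arbitrary: y)
  case (less x)
  then show ?case
    using rank_le_iff[of R x y] rank_le_iff[of R y x] by blast
qed

text \<open>Otherwise \<open>x\<close>, being below \<open>y\<close>, is bounded by some
  \<open>x'\<close> below \<open>x\<close>, which contradicts the induction hypothesis for the pair
  \<open>x'\<close>, \<open>x\<close>.\<close>

lemma not_rank_le_if_less:
  assumes "wf R" "(x, y) \<in> R"
  shows "\<not> rank_le R y x"
  using assms
proof (induction y arbitrary: x)
  case (less y)
  then show ?case
    using rank_le_iff[of R y x] by blast
qed

text \<open>A strict comparison of ranks factors through an \<open>R\<close>-step. The required
  \<open>y'\<close> is the one witnessing the failure of \<open>rank_le R y x\<close>: it is bounded
  by no \<open>x'\<close> below \<open>x\<close>, so by induction each \<open>x'\<close> is bounded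
  below \<open>y'\<close>.\<close>

lemma rank_le_predecessor:
  assumes "wf R" "\<not> rank_le R y x"
  shows "\<exists>y'. (y', y) \<in> R \<and> rank_le R x y'"
  using assms
proof (induction y arbitrary: x)
  case (less y)
  then obtain y' where y': "(y', y) \<in> R" "\<And>x'. (x', x) \<in> R \<Longrightarrow> \<not> rank_le R y' x'"
    using rank_le_iff[of R y x] by blast
  with less.IH have "rank_le R x y'"
    unfolding rank_le_iff[of R x y'] by blast
  with y' show ?case by blast
qed

lemma wf_rank_less:
  assumes "wf R"
  shows "wf {(x, y). \<not> rank_le R y x}" (is "wf ?L")
proof (rule acc_wfI)
  \<comment> \<open>Induction along \<open>R\<close> works only for a claim about all
    \<open>x\<close> of rank at most that of \<open>y\<close>: a \<open>z\<close> of smaller rank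
    than \<open>x\<close> need not be \<open>R\<close>-below anything, but its rank is bounded by
    that of an \<open>R\<close>-predecessor of \<open>y\<close>.\<close>
  have acc: "x \<in> Wellfounded.acc ?L" if "rank_le R x y" for x y
    using assms that
  proof (induction y arbitrary: x)
    case (less y)
    show ?case
    proof (rule accI)
      fix z
      assume "(z, x) \<in> ?L"
      then have "\<not> rank_le R y z"
        using less.prems rank_le_trans[of R x y z] by auto
      from rank_le_predecessor[OF assms this]
      obtain y' where "(y', y) \<in> R" "rank_le R z y'"
        by (elim exE conjE)
      then show "z \<in> Wellfounded.acc ?L"
        by (rule less.IH)
    qed
  qed
  have "rank_le R x x" for x
    using rank_le_linear[OF assms] by blast
  then show "\<forall>x. x \<in> Wellfounded.acc ?L"
    by (intro allI acc)
qed

text \<open>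
  The rank is realized on a set of representatives of the classes of elements of equal rank.
\<close>

lemma ex_Well_order_strict_map_into:
  fixes R :: "'c rel"
  assumes "wf R"
  shows "\<exists>\<gamma> :: 'c rel. Well_order \<gamma> \<and> strict_map_into UNIV (\<lambda>x y. (x, y) \<in> R) \<gamma>"
proof -
  note linear = rank_le_linear[OF assms]
  have refl: "rank_le R x x" for x
    using linear by blast
  define rep where "rep x = (SOME y. rank_le R x y \<and> rank_le R y x)" for x
  have rep: "rank_le R x (rep x)" "rank_le R (rep x) x" for x
    unfolding rep_def using someI[of "\<lambda>y. rank_le R x y \<and> rank_le R y x", OF conjI[OF refl refl]]
    by blast+
  have rep_cong: "rep x = rep y" if "rank_le R x y" "rank_le R y x" for x y
  proof -
    \<comment> \<open>Equal ranks give the same predicate under \<open>SOME\<close>, so the chosen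
      representatives coincide.\<close>
    have "(rank_le R x z \<and> rank_le R z x) = (rank_le R y z \<and> rank_le R z y)" for z
      using that rank_le_trans by metis
    then show ?thesis
      by (simp add: rep_def)
  qed
  have antisym: "x = y" if xy: "x \<in> range rep" "y \<in> range rep" "rank_le R x y" "rank_le R y x" for x y
  proof -
    obtain u v where uv: "x = rep u" "y = rep v"
      using xy(1,2) by blast
    have "rank_le R u v"
      using rank_le_trans[OF rank_le_trans[OF rep(1) xy(3)[unfolded uv]] rep(2)] .
    moreover have "rank_le R v u"
      using rank_le_trans[OF rank_le_trans[OF rep(1) xy(4)[unfolded uv]] rep(2)] .
    ultimately show ?thesis
      unfolding uv by (rule rep_cong)
  qed
  define \<gamma> where "\<gamma> = {(x, y). x \<in> range rep \<and> y \<in> range rep \<and> rank_le R x y}"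
  have Field: "Field \<gamma> = range rep"
    using refl by (auto simp: \<gamma>_def Field_def)
  have "\<gamma> - Id \<subseteq> {(x, y). \<not> rank_le R y x}"
    using antisym by (auto simp: \<gamma>_def)
  then have "wf (\<gamma> - Id)"
    using wf_subset wf_rank_less[OF assms] by blast
  moreover have "refl_on (range rep) \<gamma>" "\<gamma> \<subseteq> range rep \<times> range rep"
    using refl by (auto simp: refl_on_def \<gamma>_def)
  moreover have "trans \<gamma>"
    using rank_le_trans[of R] by (auto simp: \<gamma>_def intro!: transI)
  moreover have "antisym \<gamma>"
    using antisym by (auto simp: \<gamma>_def intro!: antisymI)
  moreover have "total_on (range rep) \<gamma>"
    using linear by (auto simp: total_on_def \<gamma>_def)
  ultimately have "Well_order \<gamma>"
    unfolding Field well_order_on_def linear_order_on_def partial_order_on_def preorder_on_def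
    by blast
  moreover have "strict_map_into UNIV (\<lambda>x y. (x, y) \<in> R) \<gamma>"
  proof (rule strict_map_intoI)
    show "rep x \<in> Field \<gamma>" for x
      using Field by auto
    fix x y
    assume "(x, y) \<in> R"
    then have not_le: "\<not> rank_le R y x"
      using not_rank_le_if_less[OF assms] by blast
    then have "rank_le R x y"
      using linear by blast
    then have "rank_le R (rep x) (rep y)"
      using rank_le_trans[OF rank_le_trans[OF rep(2)] rep(1)] by blast
    \<comment> \<open>Equality would give \<open>y\<close> \<le> \<open>rep y\<close> =
      \<open>rep x\<close> \<le> \<open>x\<close> in rank.\<close>
    moreover have "rep x \<noteq> rep y"
      using not_le rank_le_trans[of R y "rep y" x] rep by metis
    ultimately show "(rep x, rep y) \<in> \<gamma> - Id"
      by (auto simp: \<gamma>_def)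
  qed
  ultimately show ?thesis by blast
qed

lemma ex_is_height:
  fixes A :: "'c set"
  assumes "wf {(x, y). x \<in> A \<and> y \<in> A \<and> R x y}"
  shows "\<exists>\<gamma> :: 'c rel. is_height A R \<gamma>"
proof -
  define W where "W = {\<gamma> :: 'c rel. Well_order \<gamma> \<and> strict_map_into A R \<gamma>}"
  obtain \<gamma>' :: "'c rel" where wo: "Well_order \<gamma>'"
    and "strict_map_into UNIV (\<lambda>x y. (x, y) \<in> {(x, y). x \<in> A \<and> y \<in> A \<and> R x y}) \<gamma>'"
    using ex_Well_order_strict_map_into[OF assms] by (elim exE conjE)
  from this(2) have "strict_map_into A R \<gamma>'"
  proof (rule strict_map_intoE)
    fix f
    assume "\<And>x. x \<in> UNIV \<Longrightarrow> f x \<in> Field \<gamma>'"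
      and "\<And>x y. x \<in> UNIV \<Longrightarrow> y \<in> UNIV \<Longrightarrow>
        (x, y) \<in> {(x, y). x \<in> A \<and> y \<in> A \<and> R x y} \<Longrightarrow> (f x, f y) \<in> \<gamma>' - Id"
    then show ?thesis
      by (intro strict_map_intoI[where f = f]) simp_all
  qed
  with wo have "\<gamma>' \<in> W"
    by (simp add: W_def)
  then have "W \<noteq> {}" "\<forall>\<gamma>\<in>W. Well_order \<gamma>"
    by (auto simp: W_def)
  then obtain \<gamma> where "\<gamma> \<in> W" "\<forall>\<delta>\<in>W. \<gamma> \<le>o \<delta>"
    using exists_minim_Well_order by blast
  then have "is_height A R \<gamma>"
    by (simp add: is_height_def W_def)
  then show ?thesis by blast
qed

theorem theorem3p6:
  fixes P :: "'a set" and le :: "'a rel"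
  assumes "partial_order_on P le"
    and "FAC P le"
  shows "(\<exists>\<gamma> :: 'a list rel. is_width P le \<gamma> \<and> is_height (antichains P le) (\<lambda>S T. S \<supset> T) \<gamma>) \<and>
    (\<forall>\<gamma> :: 'b rel. is_width P le \<gamma> \<longleftrightarrow> is_height (antichains P le) (\<lambda>S T. S \<supset> T) \<gamma>)"
proof -
  have refl: "refl_on P le"
    using assms(1) by (simp add: partial_order_on_def preorder_on_def)
  note same_maps = strict_map_into_Inc_iff_antichains[OF refl assms(2)]
  have "\<exists>\<gamma> :: 'a list rel. is_width P le \<gamma>"
    unfolding is_width_def by (rule ex_is_height[OF wf_Inc[OF refl assms(2)]])
  \<comment> \<open>The equivalence is needed at two types: here at that of the existing width, then
    at the arbitrary type \<open>'b\<close>.\<close>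
  moreover have "is_width P le \<gamma> \<longleftrightarrow> is_height (antichains P le) (\<lambda>S T. S \<supset> T) \<gamma>"
    for \<gamma> :: "'a list rel"
    unfolding is_width_def is_height_def using same_maps by blast
  moreover have "is_width P le \<gamma> \<longleftrightarrow> is_height (antichains P le) (\<lambda>S T. S \<supset> T) \<gamma>"
    for \<gamma> :: "'b rel"
    unfolding is_width_def is_height_def using same_maps by blast
  ultimately show ?thesis by blast
qed

end
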